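(* Fix $n\geq 2$. Let $\mathfrak{m}$ be a convex $n$-dimensional polytope in $\mathbb{R}^n$ with vertex set $\{\mathbf{v}_i\}$. Given any set of generalized barycentric coordinates $\{\lambda_i\}$ associated to $\mathfrak{m}$, $$\sum_{i,j}\lambda_i\nabla\lambda_j(\mathbf{v}_j-\mathbf{v}_i)^T=\mathbb{I},$$ where $\mathbb{I}$ is the $n\times n$ identity matrix. Further, for any real $n\times n$ matrix $\mathbb{A}$, $$\sum_{i,j}(\mathbb{A}\mathbf{v}_i\cdot\mathbf{v}_j)(\lambda_i\nabla\lambda_j)=\mathbb{A}\mathbf{x}.$$ Thus, $\operatorname{span}\{\lambda_i\nabla\lambda_j : \mathbf{v}_i,\mathbf{v}_j\in\mathfrak{m}\}\supseteq\mathcal{P}_1\Lambda^1(\mathfrak{m})$.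
   Context: Generalized barycentric coordinates on $\mathfrak{m}$: non-negative functions $\lambda_i:\mathfrak{m}\to\mathbb{R}$, one for each vertex $\mathbf{v}_i$, such that every linear function $L$ (polynomial of degree at most 1) satisfies $L=\sum_i L(\mathbf{v}_i)\lambda_i$ on $\mathfrak{m}$. All sums run over all vertex indices of $\mathfrak{m}$ independently. Vectors (vertices, gradients, and $\mathbf{x}=(x_1,\ldots,x_n)^T$, the position) are column vectors; $\mathbf{v}_i\in\mathfrak{m}$ in the span refers to vertices of $\mathfrak{m}$. The $\lambda_i$ are assumed differentiable wherever gradients are written: the identities and the span inclusion are understood as statements about functions of $\mathbf{x}$ on the set of points of $\mathfrak{m}$ at which all $\lambda_i$ are differentiable relative to $\mathfrak{m}$ (i.e. $\lambda_i(\mathbf{y})=\lambda_i(\mathbf{x})+\nabla\lambda_i(\mathbf{x})\cdot(\mathbf{y}-\mathbf{x})+o(|\mathbf{y}-\mathbf{x}|)$ for $\mathbf{y}\in\mathfrak{m}$). $\mathcal{P}_1\Lambda^1(\mathfrak{m})$ is the space of differential 1-forms on $\mathfrak{m}$ with polynomial coefficients of degree at most 1, identified via vector proxies $u_1dx_1+\cdots+u_ndx_n\leftrightarrow(u_1,\ldots,u_n)^T$ with the vector fields all of whose components are polynomials of degree at most 1. Span means finite real linear combinations. *)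

theory Defs
  imports "HOL-Analysis.Analysis" "HOL-Library.Function_Algebras"
begin

text \<open>
  Vector-valued functions form a real vector space under the pointwise operations, so that the
  library's \<open>span\<close> (finite real linear combinations) applies to them.
\<close>

instantiation "fun" :: (type, real_vector) real_vector
begin

definition scaleR_fun :: "real \<Rightarrow> ('a \<Rightarrow> 'b) \<Rightarrow> 'a \<Rightarrow> 'b"
  where "scaleR_fun c f = (\<lambda>x. c *\<^sub>R f x)"

instance
  by standard (simp_all add: scaleR_fun_def fun_eq_iff scaleR_add_right scaleR_add_left)

end

definition vertices :: "'a::real_vector set \<Rightarrow> 'a set"
  where "vertices P = {w. w extreme_point_of P}"

definition polynomial_deg_le_1 :: "(real ^ 'n \<Rightarrow> real) \<Rightarrow> bool"
  where "polynomial_deg_le_1 L \<longleftrightarrow> (\<exists>c a. \<forall>x. L x = c + (\<Sum>k\<in>UNIV. a k * x $ k))"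

text \<open>
  Nothing is required of the values \<open>lam i x\<close> for \<open>x\<close> outside \<open>P\<close>.
\<close>

definition generalized_barycentric_coordinates ::
    "(real ^ 'n) set \<Rightarrow> 'i set \<Rightarrow> ('i \<Rightarrow> real ^ 'n) \<Rightarrow> ('i \<Rightarrow> real ^ 'n \<Rightarrow> real) \<Rightarrow> bool"
  where "generalized_barycentric_coordinates P I v lam \<longleftrightarrow>
    (\<forall>i\<in>I. \<forall>x\<in>P. 0 \<le> lam i x) \<and>
    (\<forall>L. polynomial_deg_le_1 L \<longrightarrow> (\<forall>x\<in>P. L x = (\<Sum>i\<in>I. L (v i) * lam i x)))"

definition differentiability_points ::
    "(real ^ 'n) set \<Rightarrow> 'i set \<Rightarrow> ('i \<Rightarrow> real ^ 'n \<Rightarrow> real) \<Rightarrow> (real ^ 'n) set"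
  where "differentiability_points P I lam = {x\<in>P. \<forall>i\<in>I. lam i differentiable (at x within P)}"

text \<open>
  The gradient relative to \<open>P\<close>: the vector representing the Frechet derivative of \<open>f\<close> within \<open>P\<close>.
  This derivative is unique at every point of a full-dimensional convex set \<open>P\<close>,
  boundary points included.
\<close>

definition gradient_within :: "(real ^ 'n) set \<Rightarrow> (real ^ 'n \<Rightarrow> real) \<Rightarrow> real ^ 'n \<Rightarrow> real ^ 'n"
  where "gradient_within P f x = (\<chi> k. frechet_derivative f (at x within P) (axis k 1))"

lemma gradient_within_works:
  assumes "f differentiable (at x within P)"
  shows "(f has_derivative (\<lambda>h. gradient_within P f x \<bullet> h)) (at x within P)"
proof -
  let ?D = "frechet_derivative f (at x within P)"
  have D: "(f has_derivative ?D) (at x within P)"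
    using assms frechet_derivative_works by blast
  then have lin: "linear ?D"
    by (simp add: has_derivative_linear)
  have "?D h = gradient_within P f x \<bullet> h" for h
  proof -
    have "?D h = ?D (\<Sum>k\<in>UNIV. h $ k *\<^sub>R axis k 1)"
      using basis_expansion[of h] by (simp add: scalar_mult_eq_scaleR)
    also have "\<dots> = (\<Sum>k\<in>UNIV. h $ k * ?D (axis k 1))"
      by (simp add: linear_sum[OF lin] linear_cmul[OF lin])
    also have "\<dots> = gradient_within P f x \<bullet> h"
      by (simp add: gradient_within_def inner_vec_def mult.commute)
    finally show ?thesis .
  qed
  then have "?D = (\<lambda>h. gradient_within P f x \<bullet> h)" by blast
  with D show ?thesis by simp
qed

text \<open>
  The matrix \<open>a b\<^sup>T\<close> of two column vectors, as an \<open>n \<times> 1\<close> by \<open>1 \<times> n\<close> matrix product.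
\<close>

definition outer_product :: "real ^ 'n \<Rightarrow> real ^ 'n \<Rightarrow> real ^ 'n ^ 'n"
  where "outer_product a b = (columnvector a :: real ^ 1 ^ 'n) ** (rowvector b :: real ^ 'n ^ 1)"

text \<open>
  Vector proxies of the 1-forms with polynomial coefficients of degree at most 1, as functions
  on \<open>S\<close>. Functions on \<open>S\<close> are represented, via \<open>restrict\<close>, by total functions that are
  \<open>undefined\<close> outside \<open>S\<close>.
\<close>

definition P1_Lambda1 :: "(real ^ 'n) set \<Rightarrow> (real ^ 'n \<Rightarrow> real ^ 'n) set"
  where "P1_Lambda1 S = (\<lambda>u. restrict u S) ` {u. \<forall>k. polynomial_deg_le_1 (\<lambda>x. u x $ k)}"

text \<open>
  The span of a family of vector fields as functions on \<open>S\<close>; restriction to \<open>S\<close> is linear, so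
  restricting the combinations amounts to combining the restrictions.
\<close>

definition span_on :: "(real ^ 'n) set \<Rightarrow> (real ^ 'n \<Rightarrow> real ^ 'n) set \<Rightarrow> (real ^ 'n \<Rightarrow> real ^ 'n) set"
  where "span_on S F = (\<lambda>w. restrict w S) ` span F"

end

theory Submission
  imports Defs
begin

text \<open>
  Differentiating the identity \<open>L = (\<Sum>j. L (v j) * lam j)\<close> along \<open>P\<close> expresses the gradient of every
  affine \<open>L\<close> as \<open>\<Sum>j. L (v j) *\<^sub>R grad (lam j)\<close>; this is legitimate even at boundary points, as the
  derivative within a full-dimensional convex set is unique. For fixed \<open>i\<close>, each of the claims is
  this formula for a suitable \<open>L\<close> depending on \<open>v i\<close>; summing over \<open>i\<close> with weights \<open>lam i\<close>
  then reproduces an affine map from its values at the vertices.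
\<close>

lemma polynomial_deg_le_1_inner: "polynomial_deg_le_1 L \<longleftrightarrow> (\<exists>c a. \<forall>x. L x = c + a \<bullet> x)"
proof
  assume "polynomial_deg_le_1 L"
  then obtain c a where "\<forall>x. L x = c + (\<Sum>k\<in>UNIV. a k * x $ k)"
    unfolding polynomial_deg_le_1_def by blast
  then have "\<forall>x. L x = c + (\<chi> k. a k) \<bullet> x" by (simp add: inner_vec_def)
  then show "\<exists>c a. \<forall>x. L x = c + a \<bullet> x" by blast
next
  assume "\<exists>c a. \<forall>x. L x = c + a \<bullet> x"
  then show "polynomial_deg_le_1 L"
    unfolding polynomial_deg_le_1_def inner_vec_def inner_real_def by blast
qed

lemma polynomial_deg_le_1_vec:
  fixes u :: "real ^ 'n \<Rightarrow> real ^ 'n"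
  assumes "\<forall>k. polynomial_deg_le_1 (\<lambda>x. u x $ k)"
  obtains A b where "\<And>x. u x = A *v x + b"
proof -
  obtain c a where ca: "\<And>k x. u x $ k = c k + a k \<bullet> x"
    using assms unfolding polynomial_deg_le_1_inner by metis
  have "u x = (\<chi> k. a k) *v x + (\<chi> k. c k)" for x
    by (simp add: vec_eq_iff ca matrix_vector_mul_component)
  then show thesis by (rule that)
qed

text \<open>Restricting \<open>f\<close> to the segment from \<open>x\<close> to any
  \<open>y\<close> in \<open>P\<close> shows that \<open>a\<close> and \<open>b\<close> have the
  same inner product with \<open>y - x\<close>. So \<open>a - b\<close> has constant inner product
  with the points of \<open>P\<close>, hence with those of its affine hull, which is the whole
  space.\<close>

lemma inner_derivative_unique_within_convex:
  fixes P :: "'a::euclidean_space set"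
  assumes "convex P" "aff_dim P = int DIM('a)" "x \<in> P"
    and a: "(f has_derivative (\<lambda>h. a \<bullet> h)) (at x within P)"
    and b: "(f has_derivative (\<lambda>h. b \<bullet> h)) (at x within P)"
  shows "a = b"
proof -
  have eq: "(a - b) \<bullet> y = (a - b) \<bullet> x" if "y \<in> P" for y
  proof -
    let ?l = "\<lambda>t::real. x + t *\<^sub>R (y - x)"
    have l: "?l ` {0..1} \<subseteq> P"
    proof clarify
      fix t :: real assume "t \<in> {0..1}"
      then have "(1 - t) *\<^sub>R x + t *\<^sub>R y \<in> P"
        using convexD_alt[OF \<open>convex P\<close> \<open>x \<in> P\<close> \<open>y \<in> P\<close>] by simp
      then show "?l t \<in> P" by (simp add: algebra_simps)
    qed
    have dl: "(?l has_derivative (\<lambda>t. t *\<^sub>R (y - x))) (at 0 within {0..1})"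
      by (auto intro!: derivative_eq_intros)
    \<comment> \<open>If \<open>x\<close> is a boundary point, the segment need not extend beyond
      \<open>x\<close> inside \<open>P\<close>, so the derivative at the endpoint 0 is
      one-sided.\<close>
    have *: "((f \<circ> ?l) has_vector_derivative (c \<bullet> (y - x))) (at 0 within {0..1})"
      if c: "(f has_derivative (\<lambda>h. c \<bullet> h)) (at x within P)" for c
    proof -
      have "(f has_derivative (\<lambda>h. c \<bullet> h)) (at (?l 0) within ?l ` {0..1})"
        using has_derivative_subset[OF c l] by simp
      from diff_chain_within[OF dl this] show ?thesis
        by (simp add: has_vector_derivative_def o_def)
    qed
    have "a \<bullet> (y - x) = b \<bullet> (y - x)"
      using vector_derivative_unique_within_closed_interval[of 0 1 0 "f \<circ> ?l"] *[OF a] *[OF b] by auto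
    then show ?thesis by (simp add: algebra_simps)
  qed
  have "affine hull P = UNIV"
    using assms(2) by (simp add: aff_dim_eq_full)
  moreover have "affine hull P \<subseteq> {y. (a - b) \<bullet> y = (a - b) \<bullet> x}"
    using eq by (intro hull_minimal affine_hyperplane) auto
  \<comment> \<open>Testing at the point \<open>x + (a - b)\<close>, which may lie outside
    \<open>P\<close>, makes the squared norm of \<open>a - b\<close> vanish.\<close>
  ultimately have "(a - b) \<bullet> (x + (a - b)) = (a - b) \<bullet> x" by blast
  then show ?thesis by (simp add: inner_add_right)
qed

lemma barycentric_reproduces_affine_map:
  fixes A :: "real ^ 'n ^ 'n"
  assumes "generalized_barycentric_coordinates P I v lam" "x \<in> P"
  shows "(\<Sum>i\<in>I. lam i x *\<^sub>R (A *v v i + b)) = A *v x + b"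
proof -
  have "polynomial_deg_le_1 (\<lambda>y. (A *v y + b) $ k)" for k
    unfolding polynomial_deg_le_1_inner
    by (intro exI[of _ "b $ k"] exI[of _ "A $ k"]) (simp add: matrix_vector_mul_component)
  then have "(A *v x + b) $ k = (\<Sum>i\<in>I. (A *v v i + b) $ k * lam i x)" for k
    using assms unfolding generalized_barycentric_coordinates_def by blast
  then show ?thesis
    by (simp add: vec_eq_iff mult.commute)
qed

lemma sum_gradient_within_eq:
  fixes P :: "(real ^ 'n) set"
  assumes "convex P" "aff_dim P = int CARD('n)"
    and bary: "generalized_barycentric_coordinates P I v lam"
    and x: "x \<in> differentiability_points P I lam"
  shows "(\<Sum>j\<in>I. (c + a \<bullet> v j) *\<^sub>R gradient_within P (lam j) x) = a"
proof -
  have xP: "x \<in> P" and diff: "\<And>j. j \<in> I \<Longrightarrow> lam j differentiable (at x within P)"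
    using x unfolding differentiability_points_def by auto
  have eq: "(\<Sum>j\<in>I. (c + a \<bullet> v j) * lam j y) = c + a \<bullet> y" if "y \<in> P" for y
  proof -
    have "polynomial_deg_le_1 (\<lambda>y. c + a \<bullet> y)"
      unfolding polynomial_deg_le_1_inner by blast
    then have "c + a \<bullet> y = (\<Sum>j\<in>I. (c + a \<bullet> v j) * lam j y)"
      using bary that unfolding generalized_barycentric_coordinates_def by blast
    then show ?thesis by simp
  qed
  have "((\<lambda>y. \<Sum>j\<in>I. (c + a \<bullet> v j) * lam j y) has_derivative
      (\<lambda>h. \<Sum>j\<in>I. (c + a \<bullet> v j) * (gradient_within P (lam j) x \<bullet> h))) (at x within P)"
    by (intro has_derivative_sum has_derivative_mult_right gradient_within_works diff)
  \<comment> \<open>The two functions agree only on \<open>P\<close>, which suffices for derivatives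
    within \<open>P\<close>.\<close>
  from has_derivative_transform[OF xP eq[symmetric] this]
  have "((\<lambda>y. c + a \<bullet> y) has_derivative
      (\<lambda>h. (\<Sum>j\<in>I. (c + a \<bullet> v j) *\<^sub>R gradient_within P (lam j) x) \<bullet> h)) (at x within P)"
    by (simp add: inner_sum_left)
  moreover have "((\<lambda>y. c + a \<bullet> y) has_derivative (\<lambda>h. a \<bullet> h)) (at x within P)"
    by (auto intro!: derivative_eq_intros)
  ultimately show ?thesis
    using assms(1,2) xP by (intro inner_derivative_unique_within_convex) auto
qed

lemma outer_product_nth: "outer_product a b $ k $ l = a $ k * b $ l"
  by (simp add: outer_product_def matrix_matrix_mult_def columnvector_def rowvector_def)

text \<open>For each fixed \<open>i\<close> the sum over \<open>j\<close>, without its weight, is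
  already the identity matrix; the weights \<open>lam i x\<close> then sum to 1.\<close>

lemma sum_barycentric_outer_product:
  fixes P :: "(real ^ 'n) set"
  assumes "convex P" "aff_dim P = int CARD('n)"
    and bary: "generalized_barycentric_coordinates P I v lam"
    and x: "x \<in> differentiability_points P I lam"
  shows "(\<Sum>i\<in>I. \<Sum>j\<in>I. lam i x *\<^sub>R
    outer_product (gradient_within P (lam j) x) (v j - v i)) = mat 1"
proof -
  let ?g = "\<lambda>j. gradient_within P (lam j) x"
  have xP: "x \<in> P"
    using x unfolding differentiability_points_def by auto
  have sum_lam: "(\<Sum>i\<in>I. lam i x) = 1"
  proof -
    have "polynomial_deg_le_1 (\<lambda>_ :: real ^ 'n. 1)"
      unfolding polynomial_deg_le_1_inner by (intro exI[of _ 1] exI[of _ 0]) simp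
    then have "1 = (\<Sum>i\<in>I. 1 * lam i x)"
      using bary xP unfolding generalized_barycentric_coordinates_def by blast
    then show ?thesis by simp
  qed
  have inner: "(\<Sum>j\<in>I. ?g j $ k * (v j - v i) $ l) = mat 1 $ k $ l" for i k l
  proof -
    \<comment> \<open>Column \<open>l\<close> comes from the affine function that sends
      \<open>y\<close> to \<open>(y - v i) $ l\<close>, whose gradient is
      \<open>axis l 1\<close>.\<close>
    have "(\<Sum>j\<in>I. ?g j $ k * (v j - v i) $ l) = (\<Sum>j\<in>I. (- v i $ l + axis l 1 \<bullet> v j) *\<^sub>R ?g j) $ k"
      by (simp add: inner_axis' mult.commute)
    also have "\<dots> = axis l 1 $ k"
      by (simp only: sum_gradient_within_eq[OF assms])
    also have "\<dots> = mat 1 $ k $ l"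
      by (simp add: axis_def mat_def)
    finally show ?thesis .
  qed
  have "(\<Sum>i\<in>I. \<Sum>j\<in>I. lam i x * (?g j $ k * (v j - v i) $ l)) = mat 1 $ k $ l" for k l
    unfolding sum_distrib_left[symmetric] inner sum_distrib_right[symmetric] sum_lam by simp
  then show ?thesis
    by (simp add: vec_eq_iff outer_product_nth)
qed

text \<open>For fixed \<open>i\<close>, the affine function with gradient
  \<open>A *v v i + b\<close> turns the sum over \<open>j\<close> into that vector, weighted by
  \<open>lam i x\<close>. The shift \<open>b\<close> supplies the constant terms needed for the span
  inclusion; \<open>b = 0\<close> gives the matrix identity.\<close>

lemma sum_barycentric_gradient_affine_map:
  fixes P :: "(real ^ 'n) set" and A :: "real ^ 'n ^ 'n"
  assumes "convex P" "aff_dim P = int CARD('n)"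
    and bary: "generalized_barycentric_coordinates P I v lam"
    and x: "x \<in> differentiability_points P I lam"
  shows "(\<Sum>i\<in>I. \<Sum>j\<in>I. ((A *v v i + b) \<bullet> v j) *\<^sub>R
    (lam i x *\<^sub>R gradient_within P (lam j) x)) = A *v x + b"
proof -
  let ?g = "\<lambda>j. gradient_within P (lam j) x"
  have xP: "x \<in> P"
    using x unfolding differentiability_points_def by auto
  have "(\<Sum>j\<in>I. ((A *v v i + b) \<bullet> v j) *\<^sub>R (lam i x *\<^sub>R ?g j)) = lam i x *\<^sub>R (A *v v i + b)" for i
  proof -
    \<comment> \<open>The summand 0 is the constant term \<open>c\<close> in
      \<open>sum_gradient_within_eq\<close>.\<close>
    have "(\<Sum>j\<in>I. ((A *v v i + b) \<bullet> v j) *\<^sub>R (lam i x *\<^sub>R ?g j)) =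
        lam i x *\<^sub>R (\<Sum>j\<in>I. (0 + (A *v v i + b) \<bullet> v j) *\<^sub>R ?g j)"
      by (simp add: scaleR_sum_right mult.commute)
    then show ?thesis by (simp only: sum_gradient_within_eq[OF assms])
  qed
  then show ?thesis
    by (simp add: barycentric_reproduces_affine_map[OF bary xP])
qed

text \<open>The coefficients \<open>(A *v v i + b) \<bullet> v j\<close> in the preceding identity
  do not depend on \<open>x\<close>, so it is a linear combination of the spanning fields.\<close>

lemma P1_Lambda1_subset_span_on:
  fixes P :: "(real ^ 'n) set"
  assumes "convex P" "aff_dim P = int CARD('n)"
    and bary: "generalized_barycentric_coordinates P I v lam"
  shows "P1_Lambda1 (differentiability_points P I lam) \<subseteq>
    span_on (differentiability_points P I lam)
      {\<lambda>x. lam i x *\<^sub>R gradient_within P (lam j) x | i j. i \<in> I \<and> j \<in> I}"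
    (is "P1_Lambda1 ?D \<subseteq> span_on ?D ?F")
proof
  fix w assume "w \<in> P1_Lambda1 ?D"
  then obtain u where w: "w = restrict u ?D" and "\<forall>k. polynomial_deg_le_1 (\<lambda>x. u x $ k)"
    unfolding P1_Lambda1_def by auto
  then obtain A b where u: "\<And>x. u x = A *v x + b"
    using polynomial_deg_le_1_vec by blast
  let ?f = "\<lambda>i j x. lam i x *\<^sub>R gradient_within P (lam j) x"
  let ?s = "\<Sum>i\<in>I. \<Sum>j\<in>I. ((A *v v i + b) \<bullet> v j) *\<^sub>R ?f i j"
  \<comment> \<open>Sums in the span are sums of functions; this evaluates them pointwise. For
    infinite \<open>S\<close> both sides are 0.\<close>
  have sum_apply: "sum h S x = (\<Sum>i\<in>S. h i x)" for h :: "'i \<Rightarrow> real ^ 'n \<Rightarrow> real ^ 'n" and S x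
    by (induction S rule: infinite_finite_induct) auto
  have "?s \<in> span ?F"
    by (intro span_sum span_scale span_base) blast
  moreover have "?s x = u x" if "x \<in> ?D" for x
    using sum_barycentric_gradient_affine_map[OF assms that]
    by (simp add: sum_apply scaleR_fun_def u)
  then have "w = restrict ?s ?D"
    unfolding w by (auto simp: restrict_def)
  ultimately show "w \<in> span_on ?D ?F"
    unfolding span_on_def by blast
qed

theorem theorem4p1:
  fixes P :: "(real ^ 'n) set"
    and I :: "'i set"
    and v :: "'i \<Rightarrow> real ^ 'n"
    and lam :: "'i \<Rightarrow> real ^ 'n \<Rightarrow> real"
  assumes "CARD('n) \<ge> 2"
    and "polytope P"
    and "aff_dim P = int CARD('n)"
    and "bij_betw v I (vertices P)"
    and "generalized_barycentric_coordinates P I v lam"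
  shows "(\<forall>x \<in> differentiability_points P I lam.
            (\<Sum>i\<in>I. \<Sum>j\<in>I. lam i x *\<^sub>R
               outer_product (gradient_within P (lam j) x) (v j - v i)) = mat 1) \<and>
         (\<forall>A :: real ^ 'n ^ 'n. \<forall>x \<in> differentiability_points P I lam.
            (\<Sum>i\<in>I. \<Sum>j\<in>I. ((A *v v i) \<bullet> v j) *\<^sub>R
               (lam i x *\<^sub>R gradient_within P (lam j) x)) = A *v x) \<and>
         P1_Lambda1 (differentiability_points P I lam) \<subseteq>
           span_on (differentiability_points P I lam)
             {\<lambda>x. lam i x *\<^sub>R gradient_within P (lam j) x | i j. i \<in> I \<and> j \<in> I}"
  using sum_barycentric_outer_product[OF polytope_imp_convex[OF assms(2)] assms(3,5)]
    sum_barycentric_gradient_affine_map[OF polytope_imp_convex[OF assms(2)] assms(3,5), where b = 0]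
    P1_Lambda1_subset_span_on[OF polytope_imp_convex[OF assms(2)] assms(3,5)]
  by simp

end
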